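(* There is a deterministic algorithm for graph verification using a distance oracle whose query complexity is $$n^{1+O\left(\sqrt{(\log\log n+\log\Delta)/\log n}\right)},$$ where $\Delta$ is the maximum degree of the given graph $\hat G$ (this is $n^{1+o(1)}$ when $\Delta=n^{o(1)}$). Moreover, if $\hat G$ has treewidth $\mathrm{tw}$, the query complexity of the same algorithm is $O(\Delta(\Delta+\mathrm{tw}\log n)\,n\log^2 n)$.
   Context: Let $G=(V,E)$ be an unknown connected, unweighted, undirected simple graph with $|V|=n$, and let $\delta$ be its shortest-path metric. A distance oracle receives a pair $(u,v)\in V^2$ and returns $\delta(u,v)$. In the verification problem, an algorithm is given $V$ and a connected graph $\hat G=(V,\hat E)$, has access to the distance oracle for $G$, and must decide whether $G=\hat G$ (i.e., whether $E=\hat E$). The query complexity is the maximum number of oracle queries made. *)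

theory Defs
  imports Complex_Main
begin

section \<open>Graphs on the vertex set V = {0..<n}\<close>

text \<open>A simple undirected graph on V = {..<n} is given by a symmetric, irreflexive
  edge relation E contained in V x V (each undirected edge {u,v} appears as (u,v) and (v,u)).\<close>

definition simple_graph :: "nat \<Rightarrow> (nat \<times> nat) set \<Rightarrow> bool" where
  "simple_graph n E \<longleftrightarrow> E \<subseteq> {..<n} \<times> {..<n} \<and> sym E \<and> (\<forall>x. (x, x) \<notin> E)"

definition connected_graph :: "nat \<Rightarrow> (nat \<times> nat) set \<Rightarrow> bool" where
  "connected_graph n E \<longleftrightarrow> simple_graph n E \<and> (\<forall>u<n. \<forall>v<n. (u, v) \<in> E\<^sup>*)"

text \<open>Shortest-path metric: the least number of edges of a walk from u to v.\<close>
definition dist :: "(nat \<times> nat) set \<Rightarrow> nat \<Rightarrow> nat \<Rightarrow> nat" where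
  "dist E u v = (LEAST k. (u, v) \<in> E ^^ k)"

definition degree :: "(nat \<times> nat) set \<Rightarrow> nat \<Rightarrow> nat" where
  "degree E u = card {v. (u, v) \<in> E}"

definition max_degree :: "nat \<Rightarrow> (nat \<times> nat) set \<Rightarrow> nat" where
  "max_degree n E = Max (degree E ` {..<n})"

section \<open>Treewidth\<close>

text \<open>A tree on the (finite, nonempty) node set I with symmetric irreflexive edge relation F:
  connected, and minimally connected (removing any edge disconnects its endpoints).\<close>
definition is_tree :: "nat set \<Rightarrow> (nat \<times> nat) set \<Rightarrow> bool" where
  "is_tree I F \<longleftrightarrow> finite I \<and> I \<noteq> {} \<and> F \<subseteq> I \<times> I \<and> sym F \<and> (\<forall>x. (x, x) \<notin> F)
     \<and> (\<forall>a\<in>I. \<forall>b\<in>I. (a, b) \<in> F\<^sup>*)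
     \<and> (\<forall>a b. (a, b) \<in> F \<longrightarrow> (a, b) \<notin> (F - {(a, b), (b, a)})\<^sup>*)"

definition tree_decomposition ::
  "nat \<Rightarrow> (nat \<times> nat) set \<Rightarrow> nat set \<Rightarrow> (nat \<times> nat) set \<Rightarrow> (nat \<Rightarrow> nat set) \<Rightarrow> bool" where
  "tree_decomposition n E I F B \<longleftrightarrow> is_tree I F
     \<and> (\<forall>i\<in>I. B i \<subseteq> {..<n})
     \<and> (\<forall>v<n. \<exists>i\<in>I. v \<in> B i)
     \<and> (\<forall>u v. (u, v) \<in> E \<longrightarrow> (\<exists>i\<in>I. u \<in> B i \<and> v \<in> B i))
     \<and> (\<forall>v<n. \<forall>i j. i \<in> I \<and> v \<in> B i \<and> j \<in> I \<and> v \<in> B j \<longrightarrow>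
            (i, j) \<in> (F \<inter> ({k\<in>I. v \<in> B k} \<times> {k\<in>I. v \<in> B k}))\<^sup>*)"

text \<open>Treewidth: minimum over tree decompositions of (max bag size - 1).\<close>
definition treewidth :: "nat \<Rightarrow> (nat \<times> nat) set \<Rightarrow> nat" where
  "treewidth n E = (LEAST k. \<exists>I F B. tree_decomposition n E I F B \<and> (\<forall>i\<in>I. card (B i) \<le> k + 1))"

section \<open>Deterministic query algorithms (adaptive decision trees)\<close>

text \<open>A deterministic adaptive algorithm with oracle access is a decision tree: at an inner node
  it queries the pair (u,v) and branches on the answer; at a leaf it outputs its decision.\<close>
datatype dtree = Leaf bool | Query nat nat "nat \<Rightarrow> dtree"

primrec dt_output :: "dtree \<Rightarrow> (nat \<Rightarrow> nat \<Rightarrow> nat) \<Rightarrow> bool" where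
  "dt_output (Leaf b) = (\<lambda>d. b)"
| "dt_output (Query u v f) = (\<lambda>d. dt_output (f (d u v)) d)"

text \<open>Number of oracle queries made when running the tree against oracle d.\<close>
primrec num_queries :: "dtree \<Rightarrow> (nat \<Rightarrow> nat \<Rightarrow> nat) \<Rightarrow> nat" where
  "num_queries (Leaf b) = (\<lambda>d. 0)"
| "num_queries (Query u v f) = (\<lambda>d. Suc (num_queries (f (d u v)) d))"

end

theory Submission
  imports Defs
begin

text \<open>The verifier queries a smallest set of pairs that contains all edges of the given graph and,
  for every nonedge \<open>{x, y}\<close>, a pair \<open>(u, v)\<close> with \<open>dist u x + 1 + dist y v < dist u v\<close>; such a
  pair would be shortened by the edge \<open>{x, y}\<close>. Both bounds come from recursive constructions of
  such sets for the nonedges inside a vertex set \<open>U\<close>.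

  For bounded degree, choose few centers \<open>A\<close> with small clusters
  \<open>{v \<in> U. dist w v < dist A v}\<close>, query all pairs between the 2-neighbourhood of \<open>A\<close> and \<open>U\<close>, and
  recurse into the clusters of that neighbourhood. If \<open>a\<close> is a center nearest to \<open>x\<close> or \<open>y\<close>, say
  to \<open>x\<close>, and \<open>b\<close> lies two steps from \<open>a\<close> towards \<open>x\<close>, then either \<open>(b, y)\<close> excludes \<open>{x, y}\<close> or
  both \<open>x\<close> and \<open>y\<close> belong to the cluster of \<open>b\<close>.

  For bounded treewidth, some bag \<open>S\<close> of a tree decomposition splits \<open>U\<close> into parts of at most half
  the size. Query all pairs between the neighbourhood of \<open>S\<close> and \<open>U\<close>, and recurse into the parts: if
  \<open>x\<close> and \<open>y\<close> are in different parts, one step from \<open>S\<close> towards the nearer of them leads away from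
  the other.\<close>

section \<open>Excluding pairs, certificates and their soundness\<close>

definition excludes :: "(nat \<times> nat) set \<Rightarrow> (nat \<times> nat) set \<Rightarrow> nat \<Rightarrow> nat \<Rightarrow> bool" where
  "excludes E Q x y \<longleftrightarrow> (\<exists>(u, v)\<in>Q. dist E u x + 1 + dist E y v < dist E u v)"

definition excludes_within :: "(nat \<times> nat) set \<Rightarrow> (nat \<times> nat) set \<Rightarrow> nat set \<Rightarrow> bool" where
  "excludes_within E Q U \<longleftrightarrow>
     (\<forall>x\<in>U. \<forall>y\<in>U. x \<noteq> y \<longrightarrow> (x, y) \<notin> E \<longrightarrow> excludes E Q x y \<or> excludes E Q y x)"

text \<open>A certificate depends on the known graph alone, so the queries need not be adaptive.
  Querying \<open>E\<close> detects missing edges; the exclusions detect additional ones.\<close>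

definition certificate :: "nat \<Rightarrow> (nat \<times> nat) set \<Rightarrow> (nat \<times> nat) set \<Rightarrow> bool" where
  "certificate n E Q \<longleftrightarrow> E \<subseteq> Q \<and> Q \<subseteq> {..<n} \<times> {..<n} \<and> excludes_within E Q {..<n}"

lemma excludes_mono: "excludes E Q x y \<Longrightarrow> Q \<subseteq> Q' \<Longrightarrow> excludes E Q' x y"
  unfolding excludes_def by blast

lemma excludes_within_mono: "excludes_within E Q U \<Longrightarrow> Q \<subseteq> Q' \<Longrightarrow> excludes_within E Q' U"
  unfolding excludes_within_def using excludes_mono by metis

lemma excludesI: "(u, v) \<in> Q \<Longrightarrow> dist E u x + 1 + dist E y v < dist E u v \<Longrightarrow> excludes E Q x y"
  unfolding excludes_def by blast

lemma dist_le: "(u, v) \<in> E ^^ k \<Longrightarrow> dist E u v \<le> k"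
  unfolding dist_def by (rule Least_le)

lemma dist_self [simp]: "dist E u u = 0"
  using dist_le[of u u 0 E] by simp

lemma dist_edge_le: "(u, v) \<in> E \<Longrightarrow> dist E u v \<le> 1"
  using dist_le[of u v 1 E] by simp

locale conn_graph =
  fixes n :: nat and E :: "(nat \<times> nat) set"
  assumes connected: "connected_graph n E"
begin

lemma edges_subset: "E \<subseteq> {..<n} \<times> {..<n}" and sym_edges: "sym E"
  and irrefl_edges: "(x, x) \<notin> E"
  using connected unfolding connected_graph_def simple_graph_def by auto

lemma finite_edges: "finite E"
  using edges_subset by (rule finite_subset) auto

lemma walk_dist:
  assumes "u < n" "v < n"
  shows "(u, v) \<in> E ^^ dist E u v"
proof -
  have "(u, v) \<in> E\<^sup>*" using connected assms unfolding connected_graph_def by blast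
  then have "\<exists>k. (u, v) \<in> E ^^ k" by (rule rtrancl_imp_relpow)
  then show ?thesis unfolding dist_def by (rule LeastI_ex)
qed

lemma walk_end: "(u, v) \<in> E ^^ k \<Longrightarrow> u < n \<Longrightarrow> v < n"
  using edges_subset by (cases k) auto

lemma dist_triangle:
  assumes "u < n" "v < n" "w < n"
  shows "dist E u w \<le> dist E u v + dist E v w"
  using assms walk_dist[of u v] walk_dist[of v w] by (intro dist_le) (auto simp: relpow_add)

text \<open>Cut a shortest walk after \<open>k\<close> steps. The first piece is kept as a walk
  because membership in neighbourhoods is read off from it.\<close>

lemma dist_split:
  assumes "u < n" "v < n" "k \<le> dist E u v"
  obtains w where "w < n" "(u, w) \<in> E ^^ k" "dist E w v = dist E u v - k"
proof -
  have "(u, v) \<in> E ^^ (k + (dist E u v - k))"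
    using assms walk_dist by simp
  then obtain w where w: "(u, w) \<in> E ^^ k" "(w, v) \<in> E ^^ (dist E u v - k)"
    by (auto simp: relpow_add)
  have wn: "w < n" using w(1) assms(1) walk_end by blast
  have "dist E u w \<le> k" "dist E w v \<le> dist E u v - k" using w dist_le by auto
  moreover have "dist E u v \<le> dist E u w + dist E w v"
    using assms wn by (intro dist_triangle)
  ultimately show thesis using that[OF wn w(1)] assms by simp
qed

lemma dist_eq_0_iff: "u < n \<Longrightarrow> v < n \<Longrightarrow> dist E u v = 0 \<longleftrightarrow> u = v"
  using walk_dist[of u v] by auto

lemma dist_eq_1D: "u < n \<Longrightarrow> v < n \<Longrightarrow> dist E u v = 1 \<Longrightarrow> (u, v) \<in> E"
  using walk_dist[of u v] by auto

lemma dist_edge: "(u, v) \<in> E \<Longrightarrow> dist E u v = 1"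
  using dist_edge_le[of u v E] dist_eq_0_iff[of u v] edges_subset irrefl_edges
  by (metis (no_types, lifting) le_neq_implies_less less_one lessThan_iff mem_Sigma_iff subset_iff)

lemma dist_nonedge:
  "x < n \<Longrightarrow> y < n \<Longrightarrow> x \<noteq> y \<Longrightarrow> (x, y) \<notin> E \<Longrightarrow> 1 < dist E x y"
  using dist_eq_1D[of x y] dist_eq_0_iff[of x y] by (metis less_one linorder_neqE_nat)

text \<open>A queried nonedge excludes itself: both outer distances vanish, while
  \<open>dist E x y\<close> exceeds 1.\<close>

lemma excludes_query:
  "(x, y) \<in> Q \<Longrightarrow> x < n \<Longrightarrow> y < n \<Longrightarrow> x \<noteq> y \<Longrightarrow> (x, y) \<notin> E \<Longrightarrow> excludes E Q x y"
  using dist_nonedge by (intro excludesI[of x y]) auto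

lemma certificate_all: "certificate n E ({..<n} \<times> {..<n})"
  unfolding certificate_def excludes_within_def using edges_subset excludes_query by auto

text \<open>Confirming the edges of \<open>E\<close> gives \<open>dist G \<le> dist E\<close>, and then an extra
  edge of \<open>G\<close> would create a shortcut between an excluding pair.\<close>

lemma certificate_sound:
  assumes G: "connected_graph n G" and Q: "certificate n E Q"
    and eq: "\<And>u v. (u, v) \<in> Q \<Longrightarrow> dist G u v = dist E u v"
  shows "G = E"
proof -
  interpret G: conn_graph n G by unfold_locales (rule G)
  have EQ: "E \<subseteq> Q" and QV: "Q \<subseteq> {..<n} \<times> {..<n}" and ex: "excludes_within E Q {..<n}"
    using Q by (auto simp: certificate_def)
  have sub: "E \<subseteq> G"
  proof safe
    fix u v assume uv: "(u, v) \<in> E"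
    then have "dist G u v = 1" using eq EQ dist_edge by (metis subsetD)
    then show "(u, v) \<in> G" using uv edges_subset G.dist_eq_1D by auto
  qed
  have walk_mono: "E ^^ k \<subseteq> G ^^ k" for k
    by (induction k) (use sub in auto)
  have le: "dist G u v \<le> dist E u v" if "u < n" "v < n" for u v
    using walk_dist[OF that] walk_mono by (intro dist_le) auto
  have contra: False if xy: "(x, y) \<in> G" and excl: "excludes E Q x y" for x y
  proof -
    obtain u v where uv: "(u, v) \<in> Q" "dist E u x + 1 + dist E y v < dist E u v"
      using excl by (auto simp: excludes_def)
    have V: "u < n" "v < n" "x < n" "y < n" using uv(1) xy QV G.edges_subset by auto
    have "dist G u v \<le> dist G u x + (dist G x y + dist G y v)"
      using G.dist_triangle[of u x v] G.dist_triangle[of x y v] V by linarith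
    also have "\<dots> \<le> dist E u x + (1 + dist E y v)"
      using le V dist_edge_le[OF xy] by (intro add_mono) auto
    also have "\<dots> < dist G u v" using uv eq by simp
    finally show False by simp
  qed
  have "G \<subseteq> E"
  proof safe
    fix x y assume xy: "(x, y) \<in> G"
    show "(x, y) \<in> E"
    proof (rule ccontr)
      assume "(x, y) \<notin> E"
      moreover have "x < n" "y < n" "x \<noteq> y" using xy G.edges_subset G.irrefl_edges by auto
      ultimately have "excludes E Q x y \<or> excludes E Q y x"
        using ex by (simp add: excludes_within_def)
      then show False using contra[OF xy] contra[OF symD[OF G.sym_edges xy]] by blast
    qed
  qed
  with sub show ?thesis by simp
qed

lemma degree_le: "u < n \<Longrightarrow> degree E u \<le> max_degree n E"
  unfolding max_degree_def by (intro Max_ge) auto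

lemma card_edges_le: "card E \<le> n * max_degree n E"
proof -
  have "E = Sigma {..<n} (\<lambda>u. {v. (u, v) \<in> E})" using edges_subset by auto
  moreover have fin: "finite {v. (u, v) \<in> E}" for u
    by (rule finite_subset[of _ "{..<n}"]) (use edges_subset in auto)
  ultimately have "card E = (\<Sum>u<n. degree E u)"
    unfolding degree_def by (metis card_SigmaI finite_lessThan)
  also have "\<dots> \<le> (\<Sum>u<n. max_degree n E)" by (intro sum_mono degree_le) auto
  finally show ?thesis by simp
qed

definition nbhd :: "nat set \<Rightarrow> nat set" where
  "nbhd S = S \<union> E `` S"

lemma nbhd_subset: "S \<subseteq> {..<n} \<Longrightarrow> nbhd S \<subseteq> {..<n}"
  unfolding nbhd_def using edges_subset by auto

lemma card_nbhd_le:
  assumes "S \<subseteq> {..<n}"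
  shows "card (nbhd S) \<le> card S * (1 + max_degree n E)"
proof -
  have fin: "finite S" using assms finite_subset by blast
  have "card (E `` S) = card (\<Union>u\<in>S. {v. (u, v) \<in> E})" by (rule arg_cong[of _ _ card]) auto
  also have "\<dots> \<le> (\<Sum>u\<in>S. degree E u)" unfolding degree_def by (rule card_UN_le[OF fin])
  also have "\<dots> \<le> (\<Sum>u\<in>S. max_degree n E)" using assms by (intro sum_mono degree_le) auto
  finally show ?thesis unfolding nbhd_def using card_Un_le[of S "E `` S"] by simp
qed

end

section \<open>Centers with small clusters\<close>

text \<open>Greedy choice: some point of \<open>W\<close> lies in at least a fraction
  \<open>1 / s\<close> of the sets \<open>H v\<close> not yet hit, so each further point multiplies
  the number of unhit \<open>v\<close> by at most \<open>1 - 1 / s\<close>.\<close>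

lemma hitting_set:
  fixes s :: nat
  assumes fin: "finite W" "finite U" and "W \<noteq> {}" "s > 0"
    and H: "\<And>v. v \<in> U \<Longrightarrow> H v \<subseteq> W" "\<And>v. v \<in> U \<Longrightarrow> card W \<le> s * card (H v)"
  shows "\<exists>A\<subseteq>W. card A \<le> r \<and> real (card {v\<in>U. A \<inter> H v = {}}) \<le> card U * (1 - 1 / s) ^ r"
proof (induction r)
  case (Suc r)
  then obtain A where A: "A \<subseteq> W" "card A \<le> r"
    and le: "real (card {v\<in>U. A \<inter> H v = {}}) \<le> card U * (1 - 1 / s) ^ r" by blast
  define R where "R = {v\<in>U. A \<inter> H v = {}}"
  have finR: "finite R" using fin by (simp add: R_def)
  have RU: "R \<subseteq> U" by (auto simp: R_def)
  show ?case
  proof (cases "R = {}")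
    case True
    then have "real (card {v\<in>U. A \<inter> H v = {}}) = 0" by (simp flip: R_def)
    then show ?thesis using A \<open>s > 0\<close> by (intro exI[of _ A]) auto
  next
    case R0: False
    have "\<exists>w\<in>W. card R \<le> s * card {v\<in>R. w \<in> H v}"
    proof (rule ccontr)
      \<comment> \<open>Double counting of the pairs \<open>(w, v)\<close> with
        \<open>w \<in> H v\<close> contradicts the lower bound on each
        \<open>card (H v)\<close>.\<close>
      assume *: "\<not> ?thesis"
        have "(\<Sum>w\<in>W. s * card {v\<in>R. w \<in> H v}) < (\<Sum>w\<in>W. card R)"
          using * \<open>W \<noteq> {}\<close> fin by (intro sum_strict_mono) (auto simp: not_le)
        moreover have "(\<Sum>w\<in>W. card {v\<in>R. w \<in> H v}) = (\<Sum>v\<in>R. card {w\<in>W. w \<in> H v})"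
          by (rule sum_multicount_gen[OF fin(1) finR]) auto
        moreover have "(\<Sum>v\<in>R. card W) \<le> (\<Sum>v\<in>R. s * card {w\<in>W. w \<in> H v})"
        proof (rule sum_mono)
          fix v assume "v \<in> R"
          then have "{w\<in>W. w \<in> H v} = H v" "v \<in> U" using H RU by auto
          then show "card W \<le> s * card {w\<in>W. w \<in> H v}" using H(2) by simp
        qed
        ultimately show False by (simp add: sum_distrib_left[symmetric] mult.commute)
    qed
    then obtain w where w: "w \<in> W" "card R \<le> s * card {v\<in>R. w \<in> H v}" by blast
    have "{v\<in>U. insert w A \<inter> H v = {}} = R - {v\<in>R. w \<in> H v}" by (auto simp: R_def)
    then have "real (card {v\<in>U. insert w A \<inter> H v = {}}) = real (card R) - card {v\<in>R. w \<in> H v}"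
      using finR by (simp add: card_Diff_subset card_mono of_nat_diff)
    also have "\<dots> \<le> real (card R) - card R / s"
      using w(2) \<open>s > 0\<close> by (simp add: divide_le_eq mult.commute flip: of_nat_mult)
    also have "\<dots> = card R * (1 - 1 / s)" by (simp add: algebra_simps)
    also have "\<dots> \<le> card U * (1 - 1 / s) ^ r * (1 - 1 / s)"
      using le \<open>s > 0\<close> by (intro mult_right_mono) (auto simp: R_def)
    also have "\<dots> = card U * (1 - 1 / s) ^ Suc r" by simp
    finally have "real (card {v\<in>U. insert w A \<inter> H v = {}}) \<le> card U * (1 - 1 / s) ^ Suc r" .
    moreover have "card (insert w A) \<le> Suc r"
      using A finite_subset[OF A(1) fin(1)] by (simp add: card_insert_if)
    ultimately show ?thesis using A w by blast
  qed
qed (auto intro!: exI[of _ "{}"])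

text \<open>The clusters of Thorup and Zwick. The quantifier, in place of a distance to a set,
  yields all of \<open>U\<close> when \<open>A\<close> is empty.\<close>

definition cluster :: "('a \<Rightarrow> 'b \<Rightarrow> nat) \<Rightarrow> 'b set \<Rightarrow> 'a set \<Rightarrow> 'a \<Rightarrow> 'b set" where
  "cluster d U A w = {v\<in>U. \<forall>a\<in>A. d w v < d a v}"

lemma finite_cluster: "finite U \<Longrightarrow> finite (cluster d U A w)"
  by (simp add: cluster_def)

lemma cluster_antimono: "A \<subseteq> B \<Longrightarrow> cluster d U B w \<subseteq> cluster d U A w"
  by (auto simp: cluster_def)

lemma one_minus_inverse_power_le_half:
  fixes s :: nat
  assumes "s > 0"
  shows "(1 - 1 / real s) ^ s \<le> 1 / 2"
proof -
  have "(1 - 1 / real s) ^ s \<le> exp (- (1 / s)) ^ s"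
    using exp_ge_add_one_self[of "- (1 / real s)"] assms by (intro power_mono) auto
  also have "\<dots> = exp (- 1)" using assms by (simp flip: exp_of_nat_mult)
  also have "\<dots> \<le> 1 / 2" using exp_ge_add_one_self[of "1::real"] by (simp add: exp_minus field_simps)
  finally show ?thesis .
qed

text \<open>Choosing a center among the \<open>|W| / s\<close> points of \<open>W\<close> nearest to \<open>v\<close> leaves
  \<open>v\<close> in at most \<open>|W| / s\<close> clusters.\<close>

lemma centers_small_average:
  fixes d :: "'a \<Rightarrow> 'b \<Rightarrow> nat" and s :: nat
  assumes fin: "finite W" "finite U" and s: "s > 0" and L: "card U < 2 ^ L"
  shows "\<exists>A\<subseteq>W. card A \<le> s * L \<and> s * (\<Sum>w\<in>W. card (cluster d U A w)) \<le> card U * card W"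
proof (cases "W = {}")
  case False
  define rank where "rank w v = card {w'\<in>W. d w' v < d w v}" for w v
  define H where "H v = {w\<in>W. s * rank w v \<le> card W}" for v
  have H: "card W \<le> s * card (H v)" for v
  proof (cases "H v = W")
    case True
    then show ?thesis using s by simp
  next
    case False
    \<comment> \<open>Take a point outside \<open>H v\<close> nearest to \<open>v\<close>: all
      strictly nearer points lie in \<open>H v\<close>, and their number is its rank, which exceeds
      \<open>|W| / s\<close>.\<close>
    define w where "w = arg_min_on (\<lambda>w. d w v) (W - H v)"
    have ne: "W - H v \<noteq> {}" "finite (W - H v)" using False fin by (auto simp: H_def)
    have w: "w \<in> W - H v" using arg_min_if_finite(1)[OF ne(2,1)] by (simp add: w_def)
    have "{w'\<in>W. d w' v < d w v} \<subseteq> H v"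
      using arg_min_if_finite(2)[OF ne(2,1), of "\<lambda>w. d w v"] by (auto simp: w_def)
    then have "rank w v \<le> card (H v)"
      unfolding rank_def using fin by (intro card_mono) (auto simp: H_def)
    then have "s * rank w v \<le> s * card (H v)" by simp
    moreover have "card W \<le> s * rank w v" using w by (auto simp: H_def)
    ultimately show ?thesis by linarith
  qed
  obtain A where A: "A \<subseteq> W" "card A \<le> s * L"
    and le: "real (card {v\<in>U. A \<inter> H v = {}}) \<le> card U * (1 - 1 / s) ^ (s * L)"
    using hitting_set[OF fin False s, of H "s * L"] H by (auto simp: H_def)
  have "(1 - 1 / real s) ^ (s * L) \<le> (1 / 2) ^ L"
    unfolding power_mult using one_minus_inverse_power_le_half[OF s] s
    by (intro power_mono) auto
  then have "real (card U) * (1 - 1 / s) ^ (s * L) \<le> card U * (1 / 2) ^ L"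
    by (intro mult_left_mono) auto
  also have "\<dots> < 1"
  proof -
    have "real (card U) < 2 ^ L" using L by (metis of_nat_less_iff of_nat_numeral of_nat_power)
    then show ?thesis by (simp add: power_one_over divide_less_eq)
  qed
  \<comment> \<open>A natural number below 1 is 0, so every \<open>v\<close> is hit.\<close>
  finally have "card {v\<in>U. A \<inter> H v = {}} = 0" using le by linarith
  then have hit: "A \<inter> H v \<noteq> {}" if "v \<in> U" for v using that fin by auto
  have "s * card {w\<in>W. v \<in> cluster d U A w} \<le> card W" if "v \<in> U" for v
  proof -
    obtain a where a: "a \<in> A" "a \<in> H v" using hit \<open>v \<in> U\<close> by blast
    \<comment> \<open>If \<open>v\<close> is in the cluster of \<open>w\<close>, then
      \<open>w\<close> is strictly nearer to \<open>v\<close> than \<open>a\<close> and is counted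
      in the rank of \<open>a\<close>.\<close>
    have "card {w\<in>W. v \<in> cluster d U A w} \<le> rank a v"
      unfolding rank_def using a fin by (intro card_mono) (auto simp: cluster_def)
    then have "s * card {w\<in>W. v \<in> cluster d U A w} \<le> s * rank a v" by simp
    also have "\<dots> \<le> card W" using a by (simp add: H_def)
    finally show ?thesis .
  qed
  then have "(\<Sum>v\<in>U. s * card {w\<in>W. v \<in> cluster d U A w}) \<le> (\<Sum>v\<in>U. card W)"
    by (intro sum_mono)
  moreover have "(\<Sum>v\<in>U. card {w\<in>W. v \<in> cluster d U A w}) = (\<Sum>w\<in>W. card (cluster d U A w))"
  proof (rule sum_multicount_gen[OF fin(2,1)], safe)
    fix w
    have "{v\<in>U. v \<in> cluster d U A w} = cluster d U A w" by (auto simp: cluster_def)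
    then show "card {v\<in>U. v \<in> cluster d U A w} = card (cluster d U A w)" by simp
  qed
  ultimately show ?thesis using A by (auto simp flip: sum_distrib_left intro!: exI[of _ A])
qed auto

text \<open>By Markov's inequality the average bound fails by a factor two for at most half of the
  remaining points, so logarithmically many rounds suffice.\<close>

lemma centers_small_clusters:
  fixes d :: "'a \<Rightarrow> 'b \<Rightarrow> nat" and s :: nat
  assumes "finite W" and fin: "finite U" and s: "s > 0" and L: "card U < 2 ^ L"
    and "card W < 2 ^ j"
  shows "\<exists>A\<subseteq>W. card A \<le> j * (s * L) \<and> (\<forall>w\<in>W. s * card (cluster d U A w) \<le> 2 * card U)"
  using \<open>finite W\<close> \<open>card W < 2 ^ j\<close>
proof (induction j arbitrary: W)
  case (Suc j)
  obtain A where A: "A \<subseteq> W" "card A \<le> s * L"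
    and avg: "s * (\<Sum>w\<in>W. card (cluster d U A w)) \<le> card U * card W"
    using centers_small_average[OF Suc.prems(1) fin s L] by blast
  define R where "R = {w\<in>W. 2 * card U < s * card (cluster d U A w)}"
  have finR: "finite R" and RW: "R \<subseteq> W" using Suc.prems by (auto simp: R_def)
  have "2 * card R \<le> card W"
  proof (cases "U = {}")
    case True
    then show ?thesis by (simp add: R_def cluster_def)
  next
    case False
    have "card U * (2 * card R) = (\<Sum>w\<in>R. 2 * card U)" by simp
    also have "\<dots> \<le> (\<Sum>w\<in>R. s * card (cluster d U A w))"
      by (intro sum_mono) (auto simp: R_def)
    also have "\<dots> \<le> (\<Sum>w\<in>W. s * card (cluster d U A w))"
      using RW Suc.prems by (intro sum_mono2) auto
    also have "\<dots> \<le> card U * card W" using avg by (simp add: sum_distrib_left)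
    finally show ?thesis using False fin by (auto simp: card_gt_0_iff)
  qed
  then have "card R < 2 ^ j" using Suc.prems by simp
  then obtain B where B: "B \<subseteq> R" "card B \<le> j * (s * L)"
    and small: "\<forall>w\<in>R. s * card (cluster d U B w) \<le> 2 * card U"
    using Suc.IH[OF finR] by blast
  have "s * card (cluster d U (A \<union> B) w) \<le> 2 * card U" if "w \<in> W" for w
  proof -
    have "s * card (cluster d U (A \<union> B) w) \<le> s * card (cluster d U A w)"
      "s * card (cluster d U (A \<union> B) w) \<le> s * card (cluster d U B w)"
      using fin by (auto intro!: mult_le_mono card_mono finite_cluster cluster_antimono)
    moreover have "s * card (cluster d U A w) \<le> 2 * card U" if "w \<notin> R"
      using that \<open>w \<in> W\<close> by (auto simp: R_def not_less)
    ultimately show ?thesis using small by (meson order_trans)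
  qed
  moreover have "card (A \<union> B) \<le> Suc j * (s * L)"
    using card_Un_le[of A B] A B by simp
  moreover have "A \<union> B \<subseteq> W" using A B RW by blast
  ultimately show ?case by blast
qed auto

section \<open>Recursion over clusters for bounded degree\<close>

context conn_graph
begin

lemma excludes_near_center:
  assumes V: "A \<subseteq> {..<n}" "U \<subseteq> {..<n}" and "A \<noteq> {}"
    and Q: "nbhd (nbhd A) \<times> U \<subseteq> Q"
    and sub: "\<And>b. b \<in> nbhd (nbhd A) \<Longrightarrow> excludes_within E Q (cluster (dist E) U A b)"
  shows "excludes_within E Q U"
proof -
  have main: "excludes E Q x y \<or> excludes E Q y x"
    if xy: "x \<in> U" "y \<in> U" "x \<noteq> y" "(x, y) \<notin> E" and a: "a \<in> A"
      and near: "\<And>a'. a' \<in> A \<Longrightarrow> dist E a x \<le> dist E a' x \<and> dist E a x \<le> dist E a' y" for x y a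
  proof (cases "dist E a x \<le> 1")
    case True
    have "x \<in> nbhd A"
      using walk_dist[of a x] True a xy V by (cases "dist E a x") (auto simp: nbhd_def)
    then show ?thesis using Q xy V by (intro disjI1 excludes_query) (auto simp: nbhd_def)
  next
    case False
    then obtain b where b: "b < n" "(a, b) \<in> E ^^ 2" "dist E b x = dist E a x - 2"
      using dist_split[of a x 2] a xy V by auto
    have bN: "b \<in> nbhd (nbhd A)" using b(2) a by (auto simp: nbhd_def numeral_2_eq_2)
    show ?thesis
    proof (cases "dist E b x + 1 < dist E b y")
      case True
      then show ?thesis using Q bN xy by (intro disjI1 excludesI[of b y]) auto
    next
      case far: False
      \<comment> \<open>Here \<open>dist E b y \<le> dist E b x + 1 = dist E a x - 1\<close>, which
        is below every distance from a center to \<open>y\<close>. With \<open>b\<close> only one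
        step from \<open>a\<close> the comparison would not be strict.\<close>
      have "x \<in> cluster (dist E) U A b" "y \<in> cluster (dist E) U A b"
        using near b(3) False far xy by (fastforce simp: cluster_def)+
      then show ?thesis using sub[OF bN] xy unfolding excludes_within_def by blast
    qed
  qed
  have "excludes E Q x y \<or> excludes E Q y x"
    if xy: "x \<in> U" "y \<in> U" "x \<noteq> y" "(x, y) \<notin> E" for x y
  proof -
    have fin: "finite A" using V finite_subset by blast
    define d where "d a = min (dist E a x) (dist E a y)" for a
    define a where "a = arg_min_on d A"
    have a: "a \<in> A" using arg_min_if_finite(1)[OF fin \<open>A \<noteq> {}\<close>] by (simp add: a_def)
    have le: "d a \<le> d a'" if "a' \<in> A" for a'
      using arg_min_least[OF fin \<open>A \<noteq> {}\<close> that] by (simp add: a_def)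
    have "(y, x) \<notin> E" using xy sym_edges by (meson symE)
    show ?thesis
    proof (cases "dist E a x \<le> dist E a y")
      case True
      show ?thesis
      proof (rule main[OF xy a])
        show "dist E a x \<le> dist E a' x \<and> dist E a x \<le> dist E a' y" if "a' \<in> A" for a'
          using le[OF that] True by (simp add: d_def)
      qed
    next
      case False
      have "excludes E Q y x \<or> excludes E Q x y"
      proof (rule main[OF xy(2,1) _ \<open>(y, x) \<notin> E\<close> a])
        show "dist E a y \<le> dist E a' y \<and> dist E a y \<le> dist E a' x" if "a' \<in> A" for a'
          using le[OF that] False by (simp add: d_def)
      qed (use xy in simp)
      then show ?thesis by blast
    qed
  qed
  then show ?thesis unfolding excludes_within_def by blast
qed

text \<open>There are at most \<open>K * t\<close> clusters, each smaller than \<open>U\<close> by a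
  factor \<open>t\<close>, so the total size grows only by a factor \<open>K\<close> per level and
  the leading \<open>t\<close> does not accumulate. The 2 in \<open>2 * K\<close> absorbs the pairs
  queried at the current level.\<close>

lemma center_recursion:
  fixes t L j :: nat
  defines "K \<equiv> 2 * L\<^sup>2 * (1 + max_degree n E)\<^sup>2"
  assumes "t \<ge> 2" and L: "n < 2 ^ L" and "U \<subseteq> {..<n}" "card U < t ^ j"
  shows "\<exists>Q\<subseteq>{..<n} \<times> {..<n}. card Q \<le> t * (2 * K) ^ j * card U \<and> excludes_within E Q U"
  using \<open>U \<subseteq> {..<n}\<close> \<open>card U < t ^ j\<close>
proof (induction j arbitrary: U)
  case 0
  then have "U = {}" using finite_subset by fastforce
  then show ?case by (intro exI[of _ "{}"]) (simp add: excludes_within_def)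
next
  case (Suc j)
  have fin: "finite U" using Suc.prems(1) by (rule finite_subset) simp
  show ?case
  proof (cases "U = {}")
    case True
    then show ?thesis by (intro exI[of _ "{}"]) (simp add: excludes_within_def)
  next
    case False
    have "card U \<le> n" using card_mono[OF _ Suc.prems(1)] by simp
    then have "card U < 2 ^ L" using L by simp
    \<comment> \<open>The parameter \<open>2 * t\<close> cancels the factor 2 lost in the cluster
      bound.\<close>
    then obtain A where A: "A \<subseteq> {..<n}" "card A \<le> L * (2 * t * L)"
      and small: "\<forall>w<n. 2 * t * card (cluster (dist E) U A w) \<le> 2 * card U"
      using centers_small_clusters[of "{..<n}" U "2 * t" L L "dist E"] fin L \<open>t \<ge> 2\<close> by auto
    define N where "N = nbhd (nbhd A)"
    have NV: "N \<subseteq> {..<n}" using A by (simp add: N_def nbhd_subset)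
    have finN: "finite N" using NV finite_subset by blast
    \<comment> \<open>Without centers a cluster would be all of \<open>U\<close>, against the
      shrinkage by \<open>t \<ge> 2\<close>.\<close>
    have "A \<noteq> {}"
    proof
      assume "A = {}"
      obtain v where "v \<in> U" using False by blast
      then have "v < n" using Suc.prems by auto
      moreover have "cluster (dist E) U A v = U" using \<open>A = {}\<close> by (simp add: cluster_def)
      ultimately have "t * card U \<le> card U" using small by auto
      moreover have "card U > 0" using False fin by (simp add: card_gt_0_iff)
      ultimately show False using \<open>t \<ge> 2\<close> by auto
    qed
    have "card N \<le> card (nbhd A) * (1 + max_degree n E)"
      unfolding N_def using A by (intro card_nbhd_le nbhd_subset)
    also have "\<dots> \<le> card A * (1 + max_degree n E) * (1 + max_degree n E)"
      using A by (intro mult_le_mono card_nbhd_le) auto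
    also have "\<dots> \<le> L * (2 * t * L) * (1 + max_degree n E) * (1 + max_degree n E)"
      using A by (intro mult_le_mono) auto
    also have "\<dots> = K * t" by (simp only: K_def power2_eq_square ac_simps)
    finally have cardN: "card N \<le> K * t" .
    have small': "t * card (cluster (dist E) U A b) \<le> card U" if "b \<in> N" for b
      using small NV that by auto
    have "\<exists>Q\<subseteq>{..<n} \<times> {..<n}. card Q \<le> t * (2 * K) ^ j * card (cluster (dist E) U A b)
        \<and> excludes_within E Q (cluster (dist E) U A b)" if "b \<in> N" for b
    proof (rule Suc.IH)
      show "cluster (dist E) U A b \<subseteq> {..<n}" using Suc.prems by (auto simp: cluster_def)
      have "t * card (cluster (dist E) U A b) < t * t ^ j"
        using small'[OF that] Suc.prems(2) by (simp only: power_Suc)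
      then show "card (cluster (dist E) U A b) < t ^ j" by simp
    qed
    then have "\<forall>b\<in>N. \<exists>Q. Q \<subseteq> {..<n} \<times> {..<n}
        \<and> card Q \<le> t * (2 * K) ^ j * card (cluster (dist E) U A b)
        \<and> excludes_within E Q (cluster (dist E) U A b)" by blast
    from bchoice[OF this] obtain F where F: "\<And>b. b \<in> N \<Longrightarrow> F b \<subseteq> {..<n} \<times> {..<n}"
      "\<And>b. b \<in> N \<Longrightarrow> card (F b) \<le> t * (2 * K) ^ j * card (cluster (dist E) U A b)"
      "\<And>b. b \<in> N \<Longrightarrow> excludes_within E (F b) (cluster (dist E) U A b)" by blast
    define Q where "Q = N \<times> U \<union> (\<Union>b\<in>N. F b)"
    have "excludes_within E Q U"
    proof (rule excludes_near_center[OF A(1) Suc.prems(1) \<open>A \<noteq> {}\<close>])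
      show "nbhd (nbhd A) \<times> U \<subseteq> Q" by (auto simp: Q_def N_def)
      show "excludes_within E Q (cluster (dist E) U A b)" if "b \<in> nbhd (nbhd A)" for b
      proof (rule excludes_within_mono)
        show "excludes_within E (F b) (cluster (dist E) U A b)" "F b \<subseteq> Q"
          using F(3)[of b] that by (auto simp: Q_def N_def)
      qed
    qed
    moreover have "Q \<subseteq> {..<n} \<times> {..<n}" using NV F(1) Suc.prems by (fastforce simp: Q_def)
    moreover have "card Q \<le> t * (2 * K) ^ Suc j * card U"
    proof -
      have "card (\<Union>b\<in>N. F b) \<le> (\<Sum>b\<in>N. card (F b))" by (rule card_UN_le[OF finN])
      also have "\<dots> \<le> (\<Sum>b\<in>N. (2 * K) ^ j * card U)"
      proof (rule sum_mono)
        fix b assume b: "b \<in> N"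
        have "card (F b) \<le> (2 * K) ^ j * (t * card (cluster (dist E) U A b))"
          using F(2)[OF b] by (simp only: ac_simps)
        also have "\<dots> \<le> (2 * K) ^ j * card U" using small'[OF b] by (rule mult_le_mono2)
        finally show "card (F b) \<le> (2 * K) ^ j * card U" .
      qed
      also have "\<dots> = card N * ((2 * K) ^ j * card U)" by simp
      finally have 1: "card (\<Union>b\<in>N. F b) \<le> card N * ((2 * K) ^ j * card U)" .
      \<comment> \<open>If \<open>K = 0\<close> then \<open>N\<close> is empty; otherwise the power
        is at least 1 and the direct queries are dominated by the recursive term.\<close>
      have "K > 0 \<or> N = {}" using cardN finN by (cases "K = 0") auto
      then have "N = {} \<or> 1 \<le> (2 * K) ^ j" by (auto simp: Suc_le_eq)
      then have 2: "card N * card U \<le> card N * ((2 * K) ^ j * card U)"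
        using mult_le_mono1[of 1 "(2 * K) ^ j" "card U"] by (auto intro: mult_le_mono2)
      have "card Q \<le> card N * card U + card (\<Union>b\<in>N. F b)"
        unfolding Q_def using card_Un_le by (metis card_cartesian_product)
      also have "\<dots> \<le> 2 * (card N * ((2 * K) ^ j * card U))"  using add_mono[OF 2 1] by (subst mult_2)
      also have "\<dots> \<le> 2 * (K * t * ((2 * K) ^ j * card U))"
        using cardN by (intro mult_le_mono) auto
      also have "\<dots> = t * (2 * K) ^ Suc j * card U" by simp
      finally show ?thesis .
    qed
    ultimately show ?thesis by blast
  qed
qed

end

section \<open>Balanced separators from tree decompositions\<close>

text \<open>Reachability after deletion of the node \<open>a\<close>. The closure is reflexive at
  \<open>a\<close> as well, so components are meaningful only for starting nodes other than
  \<open>a\<close>.\<close>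

definition avoiding :: "('a \<times> 'a) set \<Rightarrow> 'a \<Rightarrow> ('a \<times> 'a) set" where
  "avoiding F a = (F \<inter> {(i, j). i \<noteq> a \<and> j \<noteq> a})\<^sup>*"

lemma avoiding_step: "(i, j) \<in> F \<Longrightarrow> i \<noteq> a \<Longrightarrow> j \<noteq> a \<Longrightarrow> (i, j) \<in> avoiding F a"
  unfolding avoiding_def by blast

lemma avoiding_refl: "(i, i) \<in> avoiding F a"
  unfolding avoiding_def by blast

lemma avoiding_trans: "(i, j) \<in> avoiding F a \<Longrightarrow> (j, k) \<in> avoiding F a \<Longrightarrow> (i, k) \<in> avoiding F a"
  unfolding avoiding_def by (rule rtrancl_trans)

lemma avoiding_sym:
  assumes "sym F" "(i, j) \<in> avoiding F a"
  shows "(j, i) \<in> avoiding F a"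
proof -
  have "sym (F \<inter> {(i, j). i \<noteq> a \<and> j \<noteq> a})" using assms(1) by (auto simp: sym_def)
  then show ?thesis using assms(2) unfolding avoiding_def by (meson sym_rtrancl symD)
qed

lemma avoiding_neq: "(i, j) \<in> avoiding F a \<Longrightarrow> i \<noteq> a \<Longrightarrow> j \<noteq> a"
  unfolding avoiding_def by (induction rule: rtrancl_induct) auto

text \<open>Follow the walk until just before its first visit to \<open>a\<close>.\<close>

lemma avoiding_reaches_neighbour:
  assumes "(i, a) \<in> F\<^sup>*" "i \<noteq> a"
  shows "\<exists>b. (i, b) \<in> avoiding F a \<and> (b, a) \<in> F"
  using assms
proof (induction rule: converse_rtrancl_induct)
  case (step i j)
  show ?case
  proof (cases "j = a")
    case True
    then show ?thesis using step.hyps avoiding_refl by metis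
  next
    case False
    then show ?thesis
      using step avoiding_step[of i j F a] avoiding_trans[of i j F a] by metis
  qed
qed simp

text \<open>Among all pairs of a tree node \<open>a\<close> and a heavy component of the tree without \<open>a\<close>, one
  with the smallest component cannot be improved by moving \<open>a\<close> one step into that component;
  since edges of the tree are bridges, this is impossible.\<close>

lemma balanced_bag:
  fixes U :: "nat set"
  assumes td: "tree_decomposition n E I F B" and U: "U \<subseteq> {..<n}"
  defines "part \<equiv> \<lambda>a i. {v\<in>U. v \<notin> B a \<and> (\<exists>j\<in>I. v \<in> B j \<and> (i, j) \<in> avoiding F a)}"
  shows "\<exists>a\<in>I. \<forall>i\<in>I - {a}. 2 * card (part a i) \<le> card U"
proof (rule ccontr)
  have finU: "finite U" using U by (rule finite_subset) simp
  have tree: "finite I" "I \<noteq> {}" "F \<subseteq> I \<times> I" "sym F" "\<And>x. (x, x) \<notin> F"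
    "\<And>a b. a \<in> I \<Longrightarrow> b \<in> I \<Longrightarrow> (a, b) \<in> F\<^sup>*"
    "\<And>a b. (a, b) \<in> F \<Longrightarrow> (a, b) \<notin> (F - {(a, b), (b, a)})\<^sup>*"
    using td unfolding tree_decomposition_def is_tree_def by auto
  define C where "C a i = {j\<in>I. (i, j) \<in> avoiding F a}" for a i
  define P where "P = {(a, i). a \<in> I \<and> i \<in> I - {a} \<and> card U < 2 * card (part a i)}"
  assume "\<not> ?thesis"
  then have heavy: "\<exists>i. (a, i) \<in> P" if "a \<in> I" for a
    using that by (auto simp: P_def not_le)
  have finP: "finite P" by (rule finite_subset[of _ "I \<times> I"]) (use tree in \<open>auto simp: P_def\<close>)
  have "P \<noteq> {}" using heavy tree(2) by blast
  obtain a i where ai: "(a, i) \<in> P" and min: "\<And>b k. (b, k) \<in> P \<Longrightarrow> card (C a i) \<le> card (C b k)"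
  proof -
    define q where "q = arg_min_on (\<lambda>(a, i). card (C a i)) P"
    have "q \<in> P" using arg_min_if_finite(1)[OF finP \<open>P \<noteq> {}\<close>] by (simp add: q_def)
    moreover have "card (C (fst q) (snd q)) \<le> card (C b k)" if "(b, k) \<in> P" for b k
      using arg_min_least[OF finP \<open>P \<noteq> {}\<close> that, of "\<lambda>(a, i). card (C a i)"]
      by (simp add: q_def split_beta)
    ultimately show thesis using that by (metis prod.collapse)
  qed
  have I: "a \<in> I" "i \<in> I" "i \<noteq> a" using ai by (auto simp: P_def)
  \<comment> \<open>Move from \<open>a\<close> to its neighbour \<open>b\<close> inside the
    component; \<open>b\<close> has a heavy component of its own, represented by
    \<open>k\<close>.\<close>
  obtain b where b: "(i, b) \<in> avoiding F a" "(b, a) \<in> F"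
    using avoiding_reaches_neighbour tree(6) I by metis
  have bI: "b \<in> I" "b \<noteq> a" using b tree(3,5) by auto
  obtain k where bk: "(b, k) \<in> P" using heavy bI by blast
  have k: "k \<in> I" "k \<noteq> b" using bk by (auto simp: P_def)
  show False
  proof (cases "(k, a) \<in> avoiding F b")
    \<comment> \<open>The heavy component at \<open>b\<close> misses \<open>a\<close>, so it lies in
      the component at \<open>a\<close> and omits \<open>b\<close>; it is strictly smaller, against
      minimality.\<close>
    case False
    have into_a: "(k, j) \<in> avoiding F a" if "(k, j) \<in> avoiding F b" for j
      using that unfolding avoiding_def
    proof (induction rule: rtrancl_induct)
      case (step j l)
      then have "(k, j) \<in> avoiding F b" "(k, l) \<in> avoiding F b"
        unfolding avoiding_def by (simp, meson rtrancl.rtrancl_into_rtrancl)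
      then have "j \<noteq> a" "l \<noteq> a" using False by auto
      then show ?case using step by (auto intro: rtrancl.rtrancl_into_rtrancl)
    qed simp
    obtain c where c: "(k, c) \<in> avoiding F b" "(c, b) \<in> F"
      using avoiding_reaches_neighbour tree(6) k bI by metis
    have "c \<noteq> a" using c False by auto
    then have "(b, c) \<in> avoiding F a"
      using c(2) bI symD[OF tree(4)] by (intro avoiding_step) auto
    then have "(i, k) \<in> avoiding F a"
      using b(1) avoiding_sym[OF tree(4) into_a[OF c(1)]] by (meson avoiding_trans)
    then have "C b k \<subseteq> C a i" using into_a avoiding_trans by (fastforce simp: C_def)
    moreover have "b \<in> C a i" using b bI by (simp add: C_def)
    moreover have "b \<notin> C b k" using avoiding_neq k by (fastforce simp: C_def)
    ultimately have "C b k \<subset> C a i" by blast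
    then have "card (C b k) < card (C a i)" using tree(1) by (intro psubset_card_mono) (simp_all add: C_def)
    then show False using min[OF bk] by simp
  next
    \<comment> \<open>Two parts larger than half of \<open>U\<close> share a vertex
      \<open>v\<close>, which lies in neither \<open>B a\<close> nor \<open>B b\<close>. Through the
      bags of \<open>v\<close>, \<open>a\<close> reaches \<open>j\<close> without \<open>b\<close>,
      and \<open>j\<close> reaches \<open>b\<close> without \<open>a\<close>; this bypasses the
      bridge between \<open>a\<close> and \<open>b\<close>.\<close>
    case True
    have "part a i \<inter> part b k \<noteq> {}"
    proof
      assume "part a i \<inter> part b k = {}"
      then have "card (part a i \<union> part b k) = card (part a i) + card (part b k)"
        using finU by (intro card_Un_disjoint) (simp_all add: part_def)
      moreover have "card (part a i \<union> part b k) \<le> card U"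
        using finU by (intro card_mono) (auto simp: part_def)
      moreover have "card U < 2 * card (part a i)" "card U < 2 * card (part b k)"
        using ai bk by (simp_all add: P_def)
      ultimately show False by linarith
    qed
    then obtain v where "v \<in> part a i" "v \<in> part b k" by blast
    then obtain j l where v: "v \<in> U" "v \<notin> B a" "v \<notin> B b"
      and j: "j \<in> I" "v \<in> B j" "(i, j) \<in> avoiding F a"
      and l: "l \<in> I" "v \<in> B l" "(k, l) \<in> avoiding F b"
      unfolding part_def by blast
    have "v < n" using v U by auto
    then have "(l, j) \<in> (F \<inter> ({k\<in>I. v \<in> B k} \<times> {k\<in>I. v \<in> B k}))\<^sup>*"
      using td j l unfolding tree_decomposition_def by blast
    moreover have "\<dots> \<subseteq> avoiding F b"
      unfolding avoiding_def using v by (intro rtrancl_mono) auto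
    ultimately have "(l, j) \<in> avoiding F b" by (rule subsetD[rotated])
    then have aj: "(a, j) \<in> avoiding F b"
      by (rule avoiding_trans[OF avoiding_trans[OF avoiding_sym[OF tree(4) True] l(3)]])
    have jb: "(j, b) \<in> avoiding F a"
      by (rule avoiding_trans[OF avoiding_sym[OF tree(4) j(3)] b(1)])
    have bridge: "avoiding F a \<subseteq> (F - {(a, b), (b, a)})\<^sup>*" "avoiding F b \<subseteq> (F - {(a, b), (b, a)})\<^sup>*"
      unfolding avoiding_def by (auto intro!: rtrancl_mono)
    have "(a, b) \<in> (F - {(a, b), (b, a)})\<^sup>*"
      by (rule rtrancl_trans[OF subsetD[OF bridge(2) aj] subsetD[OF bridge(1) jb]])
    then show False using tree(7) symD[OF tree(4) b(2)] by blast
  qed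
qed

section \<open>Recursion over separators for bounded treewidth\<close>

context conn_graph
begin

text \<open>The one-node tree with bag \<open>{..<n}\<close> is a decomposition, so the minimum
  defining \<open>treewidth\<close> is attained.\<close>

lemma treewidth_decomposition:
  "\<exists>I F B. tree_decomposition n E I F B \<and> (\<forall>i\<in>I. card (B i) \<le> treewidth n E + 1)"
proof -
  have "tree_decomposition n E {0} {} (\<lambda>_. {..<n}) \<and> (\<forall>i\<in>{0::nat}. card {..<n} \<le> n + 1)"
    using edges_subset by (auto simp: tree_decomposition_def is_tree_def sym_def)
  then have "\<exists>k I F B. tree_decomposition n E I F B \<and> (\<forall>i\<in>I. card (B i) \<le> k + 1)"
    by (intro exI)
  then show ?thesis unfolding treewidth_def by (rule LeastI_ex)
qed

text \<open>The distinct endpoints of an edge share a bag. Positivity later gives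
  \<open>w + 1 \<le> 2 * w\<close>.\<close>

lemma treewidth_pos:
  assumes "n \<ge> 2"
  shows "treewidth n E > 0"
proof (rule ccontr)
  assume "\<not> ?thesis"
  then obtain I F B where td: "tree_decomposition n E I F B" and B: "\<forall>i\<in>I. card (B i) \<le> 1"
    using treewidth_decomposition by auto
  have "dist E 0 1 \<noteq> 0" using assms dist_eq_0_iff[of 0 1] by simp
  then obtain k where "dist E 0 1 = Suc k" using not0_implies_Suc by blast
  then obtain v where v: "(0, v) \<in> E"
    using walk_dist[of 0 1] assms by (metis One_nat_def Suc_1 Suc_le_lessD less_Suc_eq_le relpow_Suc_D2 zero_less_one order_less_trans)
  then obtain i where i: "i \<in> I" "0 \<in> B i" "v \<in> B i"
    using td unfolding tree_decomposition_def by blast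
  have "finite (B i)" using td i(1) unfolding tree_decomposition_def by (meson finite_lessThan finite_subset)
  then have "0 = v" using B i by (metis One_nat_def card_le_Suc0_iff_eq)
  then show False using v irrefl_edges by blast
qed

text \<open>The separator is the balanced bag. Its sides are encoded by labels \<open>p\<close>
  constant along edges outside \<open>S\<close>, so components of the graph never have to be
  formed.\<close>

lemma balanced_separator:
  assumes U: "U \<subseteq> {..<n}"
  obtains S and p :: "nat \<Rightarrow> nat set"
  where "S \<subseteq> {..<n}" "card S \<le> treewidth n E + 1"
    and "\<And>u v. (u, v) \<in> E \<Longrightarrow> u \<notin> S \<Longrightarrow> v \<notin> S \<Longrightarrow> p u = p v"
    and "\<And>v. v \<in> U - S \<Longrightarrow> 2 * card {u\<in>U - S. p u = p v} \<le> card U"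
proof -
  obtain I F B where td: "tree_decomposition n E I F B"
    and B: "\<And>i. i \<in> I \<Longrightarrow> card (B i) \<le> treewidth n E + 1"
    using treewidth_decomposition by blast
  obtain a where a: "a \<in> I" and bal: "\<And>i. i \<in> I - {a} \<Longrightarrow>
    2 * card {v\<in>U. v \<notin> B a \<and> (\<exists>j\<in>I. v \<in> B j \<and> (i, j) \<in> avoiding F a)} \<le> card U"
    using balanced_bag[OF td U] by blast
  have symF: "sym F" using td unfolding tree_decomposition_def is_tree_def by blast
  have finU: "finite U" using U by (rule finite_subset) simp
  \<comment> \<open>The label of \<open>v\<close> is the component of the tree without
    \<open>a\<close> that carries the bags of \<open>v\<close>. For \<open>v\<close> outside
    \<open>B a\<close> the subtree of \<open>v\<close> misses \<open>a\<close>, so any one bag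
    determines the label.\<close>
  define p where "p v = {j. \<exists>i\<in>I. v \<in> B i \<and> (i, j) \<in> avoiding F a}" for v
  have p_eq: "p v = {j. (i, j) \<in> avoiding F a}"
    if v: "v < n" "v \<notin> B a" and i: "i \<in> I" "v \<in> B i" for v i
  proof -
    have "(i, k) \<in> avoiding F a" if k: "k \<in> I" "v \<in> B k" for k
    proof -
      have "(i, k) \<in> (F \<inter> ({k\<in>I. v \<in> B k} \<times> {k\<in>I. v \<in> B k}))\<^sup>*"
        using td v(1) i k unfolding tree_decomposition_def by blast
      moreover have "\<dots> \<subseteq> avoiding F a"
        unfolding avoiding_def using v by (intro rtrancl_mono) auto
      ultimately show ?thesis by (rule subsetD[rotated])
    qed
    then show ?thesis unfolding p_def using i avoiding_trans[of i _ F a] by (intro set_eqI) blast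
  qed
  show thesis
  proof (rule that[of "B a" p])
    show "B a \<subseteq> {..<n}" using td a unfolding tree_decomposition_def by blast
    show "card (B a) \<le> treewidth n E + 1" using B a .
    show "p u = p v" if uv: "(u, v) \<in> E" "u \<notin> B a" "v \<notin> B a" for u v
    proof -
      obtain i where i: "i \<in> I" "u \<in> B i" "v \<in> B i"
        using td uv(1) unfolding tree_decomposition_def by blast
      have "u < n" "v < n" using uv(1) edges_subset by auto
      then show ?thesis using p_eq uv i by metis
    qed
    show "2 * card {u\<in>U - B a. p u = p v} \<le> card U" if v: "v \<in> U - B a" for v
    proof -
      have "v < n" using v U by auto
      then obtain i where i: "i \<in> I" "v \<in> B i"
        using td unfolding tree_decomposition_def by blast
      have "i \<in> p v" using i avoiding_refl[of i F a] by (auto simp: p_def)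
      then have "{u\<in>U - B a. p u = p v}
          \<subseteq> {v\<in>U. v \<notin> B a \<and> (\<exists>j\<in>I. v \<in> B j \<and> (i, j) \<in> avoiding F a)}"
        using avoiding_sym[OF symF] unfolding p_def by blast
      then have "card {u\<in>U - B a. p u = p v}
          \<le> card {v\<in>U. v \<notin> B a \<and> (\<exists>j\<in>I. v \<in> B j \<and> (i, j) \<in> avoiding F a)}"
        using finU by (intro card_mono) simp_all
      moreover have "i \<in> I - {a}" using i v by auto
      ultimately show ?thesis using bal[of i] by linarith
    qed
  qed
qed

text \<open>Labels can change only at \<open>S\<close>. As the walk starts outside \<open>S\<close>,
  what remains from the crossing is strictly shorter.\<close>

lemma walk_crosses_separator:
  assumes sep: "\<And>u v. (u, v) \<in> E \<Longrightarrow> u \<notin> S \<Longrightarrow> v \<notin> S \<Longrightarrow> p u = p v"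
  shows "(w, y) \<in> E ^^ k \<Longrightarrow> w \<notin> S \<Longrightarrow> p w \<noteq> p y \<Longrightarrow> \<exists>s\<in>S. \<exists>k'<k. (s, y) \<in> E ^^ k'"
proof (induction k arbitrary: w)
  case (Suc k)
  obtain v where v: "(w, v) \<in> E" "(v, y) \<in> E ^^ k"
    using relpow_Suc_D2[OF Suc.prems(1)] by blast
  show ?case
  proof (cases "v \<in> S")
    case True
    then show ?thesis using v by blast
  next
    case False
    then have "p v \<noteq> p y" using sep[OF v(1) Suc.prems(2)] Suc.prems(3) by simp
    then show ?thesis using Suc.IH[OF v(2) False] less_SucI by blast
  qed
qed simp

lemma excludes_near_separator:
  assumes V: "S \<subseteq> {..<n}" "U \<subseteq> {..<n}"
    and sep: "\<And>u v. (u, v) \<in> E \<Longrightarrow> u \<notin> S \<Longrightarrow> v \<notin> S \<Longrightarrow> p u = p v"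
    and Q: "nbhd S \<times> U \<subseteq> Q"
    and sub: "\<And>v. v \<in> U - S \<Longrightarrow> excludes_within E Q {u\<in>U - S. p u = p v}"
  shows "excludes_within E Q U"
proof -
  have main: "excludes E Q x y"
    if xy: "x \<in> U - S" "y \<in> U - S" "p x \<noteq> p y" and s: "s \<in> S"
      and near: "\<And>s'. s' \<in> S \<Longrightarrow> dist E s x \<le> dist E s' x \<and> dist E s x \<le> dist E s' y" for x y s
  proof -
    have n: "s < n" "x < n" "y < n" using s xy V by auto
    have pos: "dist E s x \<ge> 1" using dist_eq_0_iff[of s x] n s xy by (cases "dist E s x") auto
    obtain w where w: "w < n" "(s, w) \<in> E ^^ 1" "dist E w x = dist E s x - 1"
      using dist_split[OF n(1,2) pos] by blast
    \<comment> \<open>Since \<open>w\<close> is nearer to \<open>x\<close> than any vertex of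
      \<open>S\<close>, it lies outside \<open>S\<close>, and a shortest walk to \<open>x\<close>
      cannot cross \<open>S\<close>; hence the labels agree.\<close>
    have "w \<notin> S" using near[of w] w(3) pos by auto
    have "p w = p x"
    proof (rule ccontr)
      assume "p w \<noteq> p x"
      then obtain s' k where s': "s' \<in> S" "k < dist E w x" "(s', x) \<in> E ^^ k"
        using walk_crosses_separator[of S p, OF sep walk_dist[OF w(1) n(2)] \<open>w \<notin> S\<close>] by blast
      then show False using near[OF s'(1)] dist_le[OF s'(3)] s'(2) w(3) by linarith
    qed
    then obtain s' k where s': "s' \<in> S" "k < dist E w y" "(s', y) \<in> E ^^ k"
      using walk_crosses_separator[of S p, OF sep walk_dist[OF w(1) n(3)] \<open>w \<notin> S\<close>] xy(3) by auto
    \<comment> \<open>The walk to \<open>y\<close> crosses \<open>S\<close> at \<open>s'\<close>, so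
      \<open>dist E w y\<close> exceeds \<open>dist E s' y\<close>, which is at least
      \<open>dist E s x = dist E w x + 1\<close>.\<close>
    have "dist E w x + 1 < dist E w y"
      using near[OF s'(1)] dist_le[OF s'(3)] s'(2) w(3) pos by simp
    moreover have "w \<in> nbhd S" using w(2) s by (auto simp: nbhd_def)
    ultimately show ?thesis using Q xy by (intro excludesI[of w y]) auto
  qed
  have "excludes E Q x y \<or> excludes E Q y x"
    if xy: "x \<in> U" "y \<in> U" "x \<noteq> y" "(x, y) \<notin> E" for x y
  proof -
    have n: "x < n" "y < n" using xy V by auto
    have yx: "(y, x) \<notin> E" using xy(4) symD[OF sym_edges] by blast
    have sub_nbhd: "S \<subseteq> nbhd S" by (auto simp: nbhd_def)
    consider "x \<in> S" | "y \<in> S" | "x \<notin> S" "y \<notin> S" "p x = p y" | "x \<notin> S" "y \<notin> S" "p x \<noteq> p y" by blast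
    then show ?thesis
    proof cases
      case 1
      then have "(x, y) \<in> Q" using Q sub_nbhd xy by blast
      then show ?thesis using excludes_query n xy by blast
    next
      case 2
      then have "(y, x) \<in> Q" using Q sub_nbhd xy by blast
      then show ?thesis using excludes_query[of y x] n xy yx by auto
    next
      case 3
      then show ?thesis using sub[of x] xy unfolding excludes_within_def by auto
    next
      case 4
      have fin: "finite S" using V(1) by (rule finite_subset) simp
      have "S \<noteq> {}" using walk_crosses_separator[of S p, OF sep walk_dist[OF n] 4(1,3)] by blast
      define d where "d s = min (dist E s x) (dist E s y)" for s
      define s where "s = arg_min_on d S"
      have s: "s \<in> S" using arg_min_if_finite(1)[OF fin \<open>S \<noteq> {}\<close>] by (simp add: s_def)
      have le: "d s \<le> d s'" if "s' \<in> S" for s'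
        using arg_min_least[OF fin \<open>S \<noteq> {}\<close> that] by (simp add: s_def)
      show ?thesis
      proof (cases "dist E s x \<le> dist E s y")
        case True
        have "excludes E Q x y"
        proof (rule main[OF _ _ 4(3) s])
          show "dist E s x \<le> dist E s' x \<and> dist E s x \<le> dist E s' y" if "s' \<in> S" for s'
            using le[OF that] True by (simp add: d_def)
        qed (use xy 4 in auto)
        then show ?thesis by blast
      next
        case False
        have "excludes E Q y x"
        proof (rule main[OF _ _ _ s])
          show "dist E s y \<le> dist E s' y \<and> dist E s y \<le> dist E s' x" if "s' \<in> S" for s'
            using le[OF that] False by (simp add: d_def)
        qed (use xy 4 in auto)
        then show ?thesis by blast
      qed
    qed
  qed
  then show ?thesis unfolding excludes_within_def by blast
qed

text \<open>The parts are disjoint, so every level costs at most \<open>D * card U\<close> pairs in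
  total, and halving limits the number of levels to \<open>j\<close>.\<close>

lemma separator_recursion:
  defines "D \<equiv> (treewidth n E + 1) * (1 + max_degree n E)"
  assumes "U \<subseteq> {..<n}" "card U < 2 ^ j"
  shows "\<exists>Q\<subseteq>{..<n} \<times> {..<n}. card Q \<le> j * D * card U \<and> excludes_within E Q U"
  using \<open>U \<subseteq> {..<n}\<close> \<open>card U < 2 ^ j\<close>
proof (induction j arbitrary: U)
  case 0
  then have "U = {}" using finite_subset by fastforce
  then show ?case by (intro exI[of _ "{}"]) (simp add: excludes_within_def)
next
  case (Suc j)
  have fin: "finite U" using Suc.prems(1) by (rule finite_subset) simp
  obtain S and p :: "nat \<Rightarrow> nat set" where S: "S \<subseteq> {..<n}" "card S \<le> treewidth n E + 1"
    and sep: "\<And>u v. (u, v) \<in> E \<Longrightarrow> u \<notin> S \<Longrightarrow> v \<notin> S \<Longrightarrow> p u = p v"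
    and bal: "\<And>v. v \<in> U - S \<Longrightarrow> 2 * card {u\<in>U - S. p u = p v} \<le> card U"
    using balanced_separator[OF Suc.prems(1)] by blast
  define part where "part c = {u\<in>U - S. p u = c}" for c
  define T where "T = p ` (U - S)"
  have "\<forall>c\<in>T. \<exists>Q. Q \<subseteq> {..<n} \<times> {..<n} \<and> card Q \<le> j * D * card (part c)
      \<and> excludes_within E Q (part c)"
  proof
    fix c assume "c \<in> T"
    then have "2 * card (part c) \<le> card U" using bal by (auto simp: T_def part_def)
    then have "card (part c) < 2 ^ j" using Suc.prems(2) by simp
    moreover have "part c \<subseteq> {..<n}" using Suc.prems(1) by (auto simp: part_def)
    ultimately show "\<exists>Q. Q \<subseteq> {..<n} \<times> {..<n} \<and> card Q \<le> j * D * card (part c)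
      \<and> excludes_within E Q (part c)" using Suc.IH by blast
  qed
  from bchoice[OF this] obtain F where F: "\<And>c. c \<in> T \<Longrightarrow> F c \<subseteq> {..<n} \<times> {..<n}"
    "\<And>c. c \<in> T \<Longrightarrow> card (F c) \<le> j * D * card (part c)"
    "\<And>c. c \<in> T \<Longrightarrow> excludes_within E (F c) (part c)" by blast
  define Q where "Q = nbhd S \<times> U \<union> (\<Union>c\<in>T. F c)"
  have "excludes_within E Q U"
  proof (rule excludes_near_separator[of S U p, OF S(1) Suc.prems(1) sep])
    show "nbhd S \<times> U \<subseteq> Q" by (auto simp: Q_def)
    show "excludes_within E Q {u\<in>U - S. p u = p v}" if "v \<in> U - S" for v
    proof (rule excludes_within_mono)
      have "p v \<in> T" using that by (auto simp: T_def)
      then show "excludes_within E (F (p v)) {u\<in>U - S. p u = p v}" "F (p v) \<subseteq> Q"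
        using F(3)[of "p v"] by (auto simp: Q_def part_def)
    qed
  qed
  moreover have "Q \<subseteq> {..<n} \<times> {..<n}"
    using nbhd_subset[OF S(1)] F(1) Suc.prems(1) unfolding Q_def by blast
  moreover have "card Q \<le> Suc j * D * card U"
  proof -
    have finT: "finite T" using fin by (simp add: T_def)
    have "card (\<Union>c\<in>T. F c) \<le> (\<Sum>c\<in>T. card (F c))" by (rule card_UN_le[OF finT])
    also have "\<dots> \<le> (\<Sum>c\<in>T. j * D * card (part c))" by (intro sum_mono F(2))
    also have "\<dots> = j * D * (\<Sum>c\<in>T. card (part c))" by (simp add: sum_distrib_left)
    also have "(\<Sum>c\<in>T. card (part c)) = card (U - S)"
      using sum.group[OF finite_Diff[OF fin] finT, of p S "\<lambda>_. 1 :: nat"]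
      by (simp only: part_def T_def card_eq_sum)
    also have "j * D * card (U - S) \<le> j * D * card U"
      using fin by (intro mult_le_mono2 card_mono) auto
    finally have 1: "card (\<Union>c\<in>T. F c) \<le> j * D * card U" .
    have "card (nbhd S) \<le> D"
      using card_nbhd_le[OF S(1)] mult_le_mono1[OF S(2), of "1 + max_degree n E"]
      unfolding D_def by linarith
    then have 2: "card (nbhd S \<times> U) \<le> D * card U"
      unfolding card_cartesian_product by (rule mult_le_mono1)
    have "card Q \<le> card (nbhd S \<times> U) + card (\<Union>c\<in>T. F c)"
      unfolding Q_def by (rule card_Un_le)
    also have "\<dots> \<le> D * card U + j * D * card U" using 2 1 by (rule add_mono)
    finally show ?thesis by (simp add: algebra_simps)
  qed
  ultimately show ?case by blast
qed

end

section \<open>Querying a smallest certificate\<close>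

primrec query_all :: "(nat \<times> nat) list \<Rightarrow> (nat \<Rightarrow> nat \<Rightarrow> nat) \<Rightarrow> dtree" where
  "query_all [] d = Leaf True"
| "query_all (p # ps) d =
     Query (fst p) (snd p) (\<lambda>r. if r = d (fst p) (snd p) then query_all ps d else Leaf False)"

lemma dt_output_query_all:
  "dt_output (query_all ps d) d' \<longleftrightarrow> (\<forall>(u, v)\<in>set ps. d' u v = d u v)"
  by (induction ps) auto

lemma num_queries_query_all: "num_queries (query_all ps d) d' \<le> length ps"
  by (induction ps) auto

text \<open>Minimizing over all certificates lets one algorithm meet both bounds, since any
  certificate bounds its cost. Only queries are counted, so finding the minimum is free.\<close>

definition min_certificate :: "nat \<Rightarrow> (nat \<times> nat) set \<Rightarrow> (nat \<times> nat) set" where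
  "min_certificate n E = (ARG_MIN card Q. certificate n E Q)"

definition verifier :: "nat \<Rightarrow> (nat \<times> nat) set \<Rightarrow> dtree" where
  "verifier n E = query_all (SOME ps. distinct ps \<and> set ps = min_certificate n E) (dist E)"

context conn_graph
begin

lemma min_certificate: "certificate n E (min_certificate n E)"
  unfolding min_certificate_def by (rule arg_min_natI[of "certificate n E", OF certificate_all])

lemma min_certificate_le: "certificate n E Q \<Longrightarrow> card (min_certificate n E) \<le> card Q"
  unfolding min_certificate_def by (rule arg_min_nat_le)

lemma verifier_list:
  obtains ps where "verifier n E = query_all ps (dist E)" "distinct ps"
    "set ps = min_certificate n E"
proof -
  have "finite (min_certificate n E)"
    using min_certificate unfolding certificate_def by (meson finite_SigmaI finite_lessThan finite_subset)
  then have "\<exists>ps. distinct ps \<and> set ps = min_certificate n E" using finite_distinct_list by blast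
  from someI_ex[OF this] show thesis using that unfolding verifier_def by blast
qed

lemma verifier_correct:
  assumes "connected_graph n G"
  shows "dt_output (verifier n E) (dist G) = (G = E)"
proof -
  obtain ps where ps: "verifier n E = query_all ps (dist E)" "set ps = min_certificate n E"
    by (rule verifier_list)
  show ?thesis
    using certificate_sound[OF assms min_certificate] unfolding ps dt_output_query_all by blast
qed

lemma num_queries_verifier_le:
  assumes "certificate n E Q"
  shows "num_queries (verifier n E) d \<le> card Q"
proof -
  obtain ps where ps: "verifier n E = query_all ps (dist E)" "distinct ps"
      "set ps = min_certificate n E"
    by (rule verifier_list)
  show ?thesis
    using num_queries_query_all[of ps "dist E" d] distinct_card[OF ps(2)] min_certificate_le[OF assms]
    by (simp add: ps)
qed

text \<open>Adding the edge set completes \<open>Q\<close> to a certificate.\<close>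

lemma num_queries_verifier_le_within:
  assumes Q: "Q \<subseteq> {..<n} \<times> {..<n}" "card Q \<le> m" "excludes_within E Q {..<n}"
  shows "num_queries (verifier n E) d \<le> n * max_degree n E + m"
proof -
  have "certificate n E (E \<union> Q)"
    using Q edges_subset excludes_within_mono[of E Q "{..<n}" "E \<union> Q"]
    by (auto simp: certificate_def)
  then have "num_queries (verifier n E) d \<le> card (E \<union> Q)" by (rule num_queries_verifier_le)
  also have "\<dots> \<le> n * max_degree n E + m"
    using card_Un_le[of E Q] card_edges_le Q(2) by linarith
  finally show ?thesis .
qed

lemma num_queries_verifier_square: "num_queries (verifier n E) d \<le> n * n"
  using num_queries_verifier_le[OF certificate_all] by simp

lemma num_queries_verifier_centers:
  assumes "t \<ge> 2" "n < 2 ^ L" "n < t ^ j"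
  shows "num_queries (verifier n E) d
    \<le> n * max_degree n E + t * (4 * L\<^sup>2 * (1 + max_degree n E)\<^sup>2) ^ j * n"
proof -
  obtain Q where Q: "Q \<subseteq> {..<n} \<times> {..<n}" "excludes_within E Q {..<n}"
    "card Q \<le> t * (2 * (2 * L\<^sup>2 * (1 + max_degree n E)\<^sup>2)) ^ j * card {..<n}"
    using center_recursion[of t L "{..<n}" j] assms by auto
  have "card Q \<le> t * (4 * L\<^sup>2 * (1 + max_degree n E)\<^sup>2) ^ j * n"
    using Q(3) by (simp only: card_lessThan mult.assoc[symmetric]) simp
  then show ?thesis using num_queries_verifier_le_within Q by blast
qed

lemma num_queries_verifier_separators:
  assumes "n < 2 ^ L"
  shows "num_queries (verifier n E) d
    \<le> n * max_degree n E + L * ((treewidth n E + 1) * (1 + max_degree n E)) * n"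
proof -
  obtain Q where Q: "Q \<subseteq> {..<n} \<times> {..<n}" "excludes_within E Q {..<n}"
    "card Q \<le> L * ((treewidth n E + 1) * (1 + max_degree n E)) * card {..<n}"
    using separator_recursion[of "{..<n}" L] assms by auto
  then show ?thesis using num_queries_verifier_le_within[OF Q(1) _ Q(2)] by simp
qed

lemma max_degree_pos:
  assumes "n \<ge> 2"
  shows "max_degree n E > 0"
proof -
  have "E \<noteq> {}"
    using connected assms unfolding connected_graph_def
    by (metis One_nat_def Suc_1 Suc_le_lessD less_imp_le less_le_trans rtrancl_empty pair_in_Id_conv zero_less_one zero_neq_one)
  then show ?thesis using card_edges_le finite_edges by (metis card_gt_0_iff gr0I le_zero_eq mult_0_right not_le)
qed

end

section \<open>Numerical estimates for the two bounds\<close>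

lemma ln_bounds_of_ge_81:
  fixes n :: nat
  assumes "n \<ge> 81"
  shows "4 \<le> ln (real n)" and "1 \<le> ln (ln (real n))"
    and "\<exists>L. n < 2 ^ L \<and> real L \<le> 2 * ln (real n)"
proof -
  \<comment> \<open>From \<open>81 = 3 ^ 4\<close> and \<open>exp 1 \<le> 3\<close> follows
    \<open>ln 81 \<ge> 4\<close>; then \<open>81 \<le> 2 ^ 7\<close> gives
    \<open>ln 2 \<ge> 4 / 7\<close>.\<close>
  have ln3: "1 \<le> ln (3::real)" using exp_le by (simp add: ln_ge_iff)
  have ln81: "4 \<le> ln (81::real)" using ln_realpow[of "3::real" 4] ln3 by simp
  have "ln 81 \<le> ln (128::real)" by (subst ln_le_cancel_iff) auto
  moreover have "ln (128::real) = 7 * ln 2" using ln_realpow[of "2::real" 7] by simp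
  ultimately have ln2: "4 / 7 \<le> ln (2::real)" using ln81 by linarith
  have "ln 81 \<le> ln (real n)" using assms by (subst ln_le_cancel_iff) auto
  with ln81 show ln4: "4 \<le> ln (real n)" by linarith
  have "exp 1 \<le> ln (real n)" using ln4 exp_le by linarith
  then show "1 \<le> ln (ln (real n))" using ln4 by (subst ln_ge_iff) auto
  define L where "L = nat \<lfloor>log 2 (real n)\<rfloor> + 1"
  have log0: "0 \<le> log 2 (real n)" using assms by simp
  have L: "log 2 (real n) < L" "real L \<le> log 2 (real n) + 1" using log0 unfolding L_def by linarith+
  have "real n = 2 powr log 2 (real n)" using assms by simp
  also have "\<dots> < 2 powr real L" using L(1) by (intro powr_less_mono) auto
  also have "\<dots> = real (2 ^ L)" by (simp add: powr_realpow)
  finally have "n < 2 ^ L" by (simp only: of_nat_less_iff)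
  moreover have "log 2 (real n) \<le> 7 / 4 * ln (real n)"
  proof -
    have "4 / 7 * log 2 (real n) \<le> ln 2 * log 2 (real n)"
      using log0 ln2 by (intro mult_right_mono) auto
    also have "\<dots> = ln (real n)" by (simp add: log_def)
    finally show ?thesis by linarith
  qed
  ultimately show "\<exists>L. n < 2 ^ L \<and> real L \<le> 2 * ln (real n)" using L ln4 by (intro exI[of _ L]) auto
qed

text \<open>With \<open>x = ln ln n + ln \<Delta>\<close> and \<open>y = ln n\<close>, a depth \<open>j \<approx> sqrt (y / x)\<close> balances the
  contribution \<open>y / j\<close> of \<open>t \<approx> n powr (1 / j)\<close> against \<open>O (j * x)\<close>.\<close>

lemma center_bound_optimized:
  fixes n D :: nat and M :: real
  assumes n: "n \<ge> 81" and D: "D \<ge> 1" and square: "M \<le> real (n * n)"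
    and rec: "\<And>t L j. t \<ge> 2 \<Longrightarrow> n < 2 ^ L \<Longrightarrow> n < t ^ j \<Longrightarrow>
      M \<le> real (n * D + t * (4 * L\<^sup>2 * (1 + D)\<^sup>2) ^ j * n)"
  shows "M \<le> real n powr (1 + 20 * sqrt ((ln (ln (real n)) + ln (real D)) / ln (real n)))"
proof -
  define y where "y = ln (real n)"
  define x where "x = ln y + ln (real D)"
  have y4: "4 \<le> y" using ln_bounds_of_ge_81[OF n] by (simp add: y_def)
  have "0 \<le> ln (real D)" using D by simp
  then have x1: "1 \<le> x" using ln_bounds_of_ge_81(2)[OF n] by (simp add: x_def y_def)
  have expy: "real n = exp y" using n by (simp add: y_def)
  have goal: "M \<le> real n powr (1 + 20 * sqrt (x / y))"
  proof (cases "y \<le> x")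
    \<comment> \<open>The claimed exponent is at least 21, so the trivial bound by all pairs
      suffices.\<close>
    case True
    then have "1 \<le> sqrt (x / y)" using y4 by simp
    have "M \<le> real n powr 2" using square n by (simp add: power2_eq_square)
    also have "\<dots> \<le> real n powr (1 + 20 * sqrt (x / y))"
    proof (rule powr_mono)
      show "2 \<le> 1 + 20 * sqrt (x / y)" using \<open>1 \<le> sqrt (x / y)\<close> by linarith
    qed (use n in simp)
    finally show ?thesis .
  next
    case False
    define a where "a = sqrt x"
    define b where "b = sqrt y"
    have ab: "1 \<le> a" "a \<le> b" "x = a * a" "y = b * b" "sqrt (x / y) = a / b"
      using x1 y4 False by (auto simp: a_def b_def real_sqrt_divide)
    define r where "r = b / a"
    define j where "j = nat \<lceil>r\<rceil>"
    have r: "1 \<le> r" using ab by (simp add: r_def)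
    have j: "r \<le> j" "real j \<le> 2 * r" "j \<ge> 1" using r unfolding j_def by linarith+
    define z where "z = real n powr (1 / j)"
    have z1: "1 \<le> z" unfolding z_def using n by (intro ge_one_powr_ge_zero) auto
    have zj: "z ^ j = real n" unfolding z_def using n j(3) by (simp add: powr_powr flip: powr_realpow)
    have "z \<le> exp (a * b)"
    proof -
      have "y / j \<le> y / r" using j r y4 by (intro divide_left_mono) auto
      also have "\<dots> = a * b" using ab by (simp add: r_def)
      finally show ?thesis by (simp add: z_def powr_def y_def)
    qed
    \<comment> \<open>Rounding up strictly ensures \<open>n < t ^ j\<close>, and
      \<open>z \<ge> 1\<close> limits the loss to a factor 2.\<close>
    define t where "t = nat \<lfloor>z\<rfloor> + 1"
    have t: "z < t" "real t \<le> 2 * z" "t \<ge> 2" using z1 unfolding t_def by linarith+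
    have "z ^ j < real t ^ j" using t z1 j by (intro power_strict_mono) auto
    then have tj: "n < t ^ j" unfolding zj by (simp flip: of_nat_power)
    obtain L where L: "n < 2 ^ L" "real L \<le> 2 * y"
      using ln_bounds_of_ge_81(3)[OF n] by (auto simp: y_def)
    define B where "B = 4 * (real L)\<^sup>2 * (1 + real D)\<^sup>2"
    \<comment> \<open>\<open>B\<close> is at most the square of
      \<open>8 * y * D = exp (ln 8 + x)\<close>, and \<open>ln 8 \<le> 3 * x\<close>.\<close>
    have "B = (2 * real L * (1 + real D))\<^sup>2" by (simp add: B_def power_mult_distrib)
    also have "\<dots> \<le> (2 * (2 * y) * (2 * real D))\<^sup>2"
      using L D y4 by (intro power_mono mult_mono) auto
    also have "\<dots> = (exp (ln 8 + x))\<^sup>2"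
      using y4 D by (simp add: x_def exp_add)
    also have "\<dots> \<le> (exp (4 * x))\<^sup>2"
    proof -
      have "ln 8 = 3 * ln (2::real)" using ln_realpow[of 2 3] by simp
      then have "ln 8 \<le> 3 * x" using ln_2_less_1 x1 by linarith
      then show ?thesis by (intro power_mono) auto
    qed
    also have "\<dots> = exp (8 * x)" by (simp flip: exp_of_nat_mult)
    finally have B: "B \<le> exp (8 * x)" .
    have "real D \<le> exp (8 * x)"
    proof -
      have "real D = exp (ln (real D))" using D by simp
      also have "\<dots> \<le> exp (8 * x)"
        using ln_bounds_of_ge_81(2)[OF n] x1 unfolding x_def y_def by simp
      finally show ?thesis .
    qed
    also have "\<dots> \<le> exp (8 * x) ^ j" using x1 j by (intro self_le_power) auto
    also have "\<dots> \<le> t * exp (8 * x) ^ j" using t by simp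
    finally have Dle: "real D \<le> t * exp (8 * x) ^ j" .
    have "M \<le> real n * (real D + t * B ^ j)"
      using rec[OF t(3) L(1) tj] by (simp add: B_def algebra_simps)
    also have "\<dots> \<le> real n * (t * exp (8 * x) ^ j + t * exp (8 * x) ^ j)"
      using Dle B by (intro mult_left_mono add_mono power_mono) (auto simp: B_def)
    also have "\<dots> = real n * (2 * t * exp (8 * x) ^ j)" by simp
    \<comment> \<open>In units of \<open>a * b = y * sqrt (x / y)\<close>, the exponent gets 1 from
      \<open>t\<close>, 16 from \<open>8 * x * j\<close> with \<open>j \<le> 2 * r\<close>, and 3
      from absorbing the constant 4: 20 in all.\<close>
    also have "\<dots> \<le> exp y * (4 * exp (a * b) * exp (16 * (a * b)))"
    proof -
      have "x * j \<le> x * (2 * r)" using j x1 by (intro mult_left_mono) auto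
      also have "\<dots> = 2 * (a * b)" using ab by (simp add: r_def)
      finally have "exp (8 * x) ^ j \<le> exp (16 * (a * b))" by (simp flip: exp_of_nat_mult)
      moreover have "2 * real t \<le> 4 * exp (a * b)" using t \<open>z \<le> exp (a * b)\<close> by linarith
      ultimately show ?thesis unfolding expy by (intro mult_left_mono mult_mono) auto
    qed
    also have "\<dots> \<le> exp y * (exp (3 * (a * b)) * exp (a * b) * exp (16 * (a * b)))"
    proof -
      have "1 * 1 \<le> a * b" using ab by (intro mult_mono) auto
      then have "4 \<le> exp (3 * (a * b))" using exp_ge_add_one_self[of "3 * (a * b)"] by linarith
      then show ?thesis by (intro mult_left_mono mult_right_mono) auto
    qed
    also have "\<dots> = exp (y + 20 * (a * b))" by (simp flip: exp_add)
    also have "\<dots> = real n powr (1 + 20 * sqrt (x / y))"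
    proof -
      have "sqrt (x / y) * y = a * b" using ab by simp
      then show ?thesis using n by (simp add: powr_def y_def[symmetric] algebra_simps)
    qed
    finally show ?thesis .
  qed
  then show ?thesis by (simp add: x_def y_def)
qed

text \<open>The bounds \<open>L \<le> 2 * y\<close>, \<open>w + 1 \<le> 2 * w\<close> and
  \<open>1 + D \<le> 2 * D\<close> produce a constant 8, which 20 covers; the square of
  \<open>y\<close> enters in the last step, from \<open>y \<ge> 1\<close>.\<close>

lemma separator_bound_simplified:
  fixes n D w L :: nat and M :: real
  assumes y: "1 \<le> y" and "D \<ge> 1" "w \<ge> 1" and L: "real L \<le> 2 * y"
    and M: "M \<le> real (n * D + L * ((w + 1) * (1 + D)) * n)"
  shows "M \<le> 20 * real D * (real D + real w * y) * real n * y\<^sup>2"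
proof -
  have y2: "1 \<le> y\<^sup>2" using y by simp
  have "real L * ((1 + real w) * (1 + real D)) \<le> (2 * y) * ((2 * real w) * (2 * real D))"
    using assms by (intro mult_mono) auto
  then have "real n * (real D + real L * ((1 + real w) * (1 + real D)))
      \<le> real n * (real D * 1 + 8 * (real D * (real w * y)))"
    by (intro mult_left_mono) (auto simp: ac_simps)
  also have "\<dots> \<le> real n * (20 * (real D * real D) + 20 * (real D * (real w * y)))"
  proof (intro mult_left_mono add_mono)
    show "real D * 1 \<le> 20 * (real D * real D)"
      using \<open>D \<ge> 1\<close> mult_left_mono[of 1 "real D" "real D"] by simp
  qed (use y in auto)
  also have "\<dots> = 20 * real D * (real D + real w * y) * real n" by (simp add: algebra_simps)
  also have "\<dots> \<le> 20 * real D * (real D + real w * y) * real n * y\<^sup>2"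
    using y y2 mult_left_mono[OF y2, of "20 * real D * (real D + real w * y) * real n"] by simp
  finally show ?thesis using M by (simp add: algebra_simps)
qed

theorem theorem1:
  "\<exists>A :: nat \<Rightarrow> (nat \<times> nat) set \<Rightarrow> dtree.
     (\<forall>n Gh G. connected_graph n Gh \<longrightarrow> connected_graph n G \<longrightarrow>
        dt_output (A n Gh) (dist G) = (G = Gh))
   \<and> (\<exists>C::real. \<exists>N::nat. C > 0 \<and>
        (\<forall>n Gh G. n \<ge> N \<longrightarrow> connected_graph n Gh \<longrightarrow> connected_graph n G \<longrightarrow>
           real (num_queries (A n Gh) (dist G))
             \<le> real n powr (1 + C * sqrt ((ln (ln (real n)) + ln (real (max_degree n Gh))) / ln (real n)))
         \<and> real (num_queries (A n Gh) (dist G))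
             \<le> C * real (max_degree n Gh)
                 * (real (max_degree n Gh) + real (treewidth n Gh) * ln (real n))
                 * real n * (ln (real n))\<^sup>2))"
proof (intro exI[of _ verifier] conjI exI[of _ "20::real"] exI[of _ "81::nat"] allI impI)
  fix n Gh G
  assume "connected_graph n Gh" and G: "connected_graph n G"
  then interpret conn_graph n Gh by unfold_locales
  show "dt_output (verifier n Gh) (dist G) = (G = Gh)" by (rule verifier_correct[OF G])
next
  \<comment> \<open>The constant 20 is the one in the center exponent and also suffices for
    separators; the threshold 81 ensures \<open>ln n \<ge> 4\<close> and
    \<open>ln (ln n) \<ge> 1\<close>.\<close>
  fix n :: nat and Gh G
  assume n: "n \<ge> 81" and "connected_graph n Gh"
  then interpret conn_graph n Gh by unfold_locales
  have D: "max_degree n Gh \<ge> 1" using max_degree_pos n by simp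
  show "real (num_queries (verifier n Gh) (dist G))
      \<le> real n powr (1 + 20 * sqrt ((ln (ln (real n)) + ln (real (max_degree n Gh))) / ln (real n)))"
    by (intro center_bound_optimized n D of_nat_mono num_queries_verifier_square
        num_queries_verifier_centers)
  obtain L where L: "n < 2 ^ L" "real L \<le> 2 * ln (real n)"
    using ln_bounds_of_ge_81(3)[OF n] by blast
  show "real (num_queries (verifier n Gh) (dist G))
      \<le> 20 * real (max_degree n Gh)
          * (real (max_degree n Gh) + real (treewidth n Gh) * ln (real n))
          * real n * (ln (real n))\<^sup>2"
  proof (rule separator_bound_simplified[OF _ D _ L(2)])
    show "1 \<le> ln (real n)" using ln_bounds_of_ge_81(1)[OF n] by simp
    show "treewidth n Gh \<ge> 1" using treewidth_pos n by simp
    show "real (num_queries (verifier n Gh) (dist G))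
      \<le> real (n * max_degree n Gh + L * ((treewidth n Gh + 1) * (1 + max_degree n Gh)) * n)"
      by (intro of_nat_mono num_queries_verifier_separators L(1))
  qed
qed simp

end
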